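(* For every infinite cardinal $\kappa\le\mathfrak c$ there is an almost disjoint family $\mathcal F\subseteq[T]^{\aleph_0}$ of cardinality $\mathfrak c$ such that $\mathfrak a^+(\mathcal F)=\kappa$.
   Context: $T={}^{\omega>}2$ (a countable set), $\mathfrak c=2^{\aleph_0}$. Almost disjoint (ad) = finite intersection; an ad family has pairwise ad distinct members. For $\mathcal X\subseteq[S]^{\aleph_0}$ with $S=\bigcup\mathcal X$, $\mathcal F\subseteq\mathcal X$ is mad in $\mathcal X$ if it is ad and no $X\in\mathcal X$ is ad to all members of $\mathcal F$; $\mathfrak a(\mathcal X)=\min\{|\mathcal F|:|\mathcal F|\ge\aleph_0,\ \mathcal F\text{ mad in }\mathcal X\}$. For an ad family $\mathcal F$ of subsets of $T$, $\mathcal F^\perp=\{Y\in[T]^{\aleph_0}:|X\cap Y|<\aleph_0\ \forall X\in\mathcal F\}$ and $\mathfrak a^+(\mathcal F)=\mathfrak a(\mathcal F^\perp)$. *)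

theory Defs
  imports Main
begin

unbundle cardinal_syntax

text \<open>Cardinals are cardinal well-orders \<^term>\<open>r\<close> with \<^term>\<open>Card_order r\<close>, compared by
  \<open>\<le>o\<close> and identified up to \<open>=o\<close>; \<^term>\<open>natLeq\<close> is aleph-zero.\<close>

definition continuum :: "(nat \<Rightarrow> bool) rel" where
  "continuum = ctwo ^c natLeq"

abbreviation T :: "bool list set" where
  "T \<equiv> UNIV"

definition ctbl_subsets :: "'a set \<Rightarrow> 'a set set" where
  "ctbl_subsets S = {Y. Y \<subseteq> S \<and> |Y| =o natLeq}"

definition ad :: "'a set \<Rightarrow> 'a set \<Rightarrow> bool" where
  "ad X Y \<longleftrightarrow> finite (X \<inter> Y)"

definition ad_family :: "'a set set \<Rightarrow> bool" where
  "ad_family F \<longleftrightarrow> pairwise ad F"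

definition mad_in :: "'a set set \<Rightarrow> 'a set set \<Rightarrow> bool" where
  "mad_in \<X> F \<longleftrightarrow> F \<subseteq> \<X> \<and> ad_family F \<and> \<not> (\<exists>X\<in>\<X>. \<forall>Y\<in>F. ad X Y)"

text \<open>The least element, up to \<open>=o\<close>, of a set of cardinals. The empty set has no least
  element and is sent to the cardinal zero, so that a minimum of infinite cardinals which
  turns out to be infinite is always attained.\<close>

definition min_card :: "'a rel set \<Rightarrow> 'a rel" where
  "min_card R = (if R = {} then {} else (SOME r. r \<in> R \<and> (\<forall>r'\<in>R. r \<le>o r')))"

lemma min_card_least:
  assumes "R \<noteq> {}" and "\<And>r. r \<in> R \<Longrightarrow> Card_order r"
  shows "min_card R \<in> R" and "r' \<in> R \<Longrightarrow> min_card R \<le>o r'"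
proof -
  have "\<exists>r. r \<in> R \<and> (\<forall>r'\<in>R. r \<le>o r')"
    using exists_minim_Card_order[of R] assms by blast
  from someI_ex[OF this] show "min_card R \<in> R" "r' \<in> R \<Longrightarrow> min_card R \<le>o r'"
    using assms(1) by (auto simp: min_card_def)
qed

definition ad_number :: "'a set set \<Rightarrow> 'a set rel" where
  "ad_number \<X> = min_card {|F| | F. natLeq \<le>o |F| \<and> mad_in \<X> F}"

definition perp :: "bool list set set \<Rightarrow> bool list set set" where
  "perp F = {Y \<in> ctbl_subsets T. \<forall>X\<in>F. finite (X \<inter> Y)}"

definition ad_number_plus :: "bool list set set \<Rightarrow> bool list set rel" where
  "ad_number_plus F = ad_number (perp F)"

end

theory Submission
  imports Defs "HOL-Library.Countable" "HOL-Library.Infinite_Set" "HOL-Library.Sublist"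
begin

text \<open>
  In the binary tree, a maximal almost disjoint family of infinite antichains together with all
  branches outside a set \<open>K\<close> of \<open>\<kappa>\<close> many branches does the job. A set almost disjoint from this
  family has no infinite antichain. By Koenig's lemma, an infinite set of nodes without infinite
  antichains meets at least one branch in an infinite set, but only finitely many of them.
  Hence the branches in \<open>K\<close> are maximal in the orthogonal, and mapping each of them to a
  member that it meets in an infinite set shows that every infinite maximal family has size at
  least \<open>\<kappa>\<close>, the map being finite-to-one.
\<close>

section \<open>Antichains and branches of the tree\<close>

definition antichain :: "'a list set \<Rightarrow> bool" where
  "antichain A \<longleftrightarrow> (\<forall>x\<in>A. \<forall>y\<in>A. prefix x y \<longrightarrow> x = y)"

definition initial_segment :: "(nat \<Rightarrow> 'a) \<Rightarrow> nat \<Rightarrow> 'a list" where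
  "initial_segment f n = map f [0..<n]"

definition branch :: "(nat \<Rightarrow> 'a) \<Rightarrow> 'a list set" where
  "branch f = range (initial_segment f)"

lemma length_initial_segment [simp]: "length (initial_segment f n) = n"
  by (simp add: initial_segment_def)

lemma nth_initial_segment [simp]: "i < n \<Longrightarrow> initial_segment f n ! i = f i"
  by (simp add: initial_segment_def)

lemma initial_segment_Suc: "initial_segment f (Suc n) = initial_segment f n @ [f n]"
  by (simp add: initial_segment_def)

lemma inj_initial_segment: "inj (initial_segment f)"
  by (metis injI length_initial_segment)

lemma mem_branch_iff: "x \<in> branch f \<longleftrightarrow> x = initial_segment f (length x)"
  unfolding branch_def by (metis length_initial_segment rangeE rangeI)

lemma infinite_branch: "infinite (branch f)"
  unfolding branch_def using inj_initial_segment by (rule range_inj_infinite)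

lemma initial_segment_eq_iff:
  "initial_segment f n = initial_segment g n \<longleftrightarrow> (\<forall>i<n. f i = g i)"
  by (auto simp: list_eq_iff_nth_eq)

lemma prefix_initial_segment_iff:
  "prefix (initial_segment f n) y \<longleftrightarrow> n \<le> length y \<and> (\<forall>i<n. y ! i = f i)"
  by (auto simp: prefix_def list_eq_iff_nth_eq nth_append intro: exI[of _ "drop n y"])

text \<open>Beyond a coordinate where \<open>f\<close> and \<open>g\<close> differ, the two branches
  share no node, and a branch has only finitely many nodes of bounded length.\<close>

lemma finite_branch_Int_branch:
  assumes "f \<noteq> g"
  shows "finite (branch f \<inter> branch g)"
proof -
  obtain i where i: "f i \<noteq> g i"
    using assms by blast
  have "branch f \<inter> branch g \<subseteq> initial_segment f ` {..i}"
  proof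
    fix x assume x: "x \<in> branch f \<inter> branch g"
    then have "initial_segment f (length x) = initial_segment g (length x)"
      by (metis IntD1 IntD2 mem_branch_iff)
    with i have "length x \<le> i"
      unfolding initial_segment_eq_iff by (meson not_le)
    with x show "x \<in> initial_segment f ` {..i}"
      by (auto simp: mem_branch_iff[of x f])
  qed
  then show ?thesis
    by (rule finite_subset) simp
qed

lemma inj_branch: "inj branch"
  using finite_branch_Int_branch infinite_branch by (metis Int_absorb injI)

lemma prefix_initial_segments: "m \<le> n \<Longrightarrow> prefix (initial_segment f m) (initial_segment f n)"
  by (simp add: prefix_initial_segment_iff)

text \<open>The nodes of a branch are pairwise comparable, so an antichain contains at most one of
  them.\<close>

lemma finite_branch_Int_antichain:
  assumes "antichain A"
  shows "finite (branch f \<inter> A)"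
proof -
  have "x = y" if xy: "x \<in> branch f \<inter> A" "y \<in> branch f \<inter> A" for x y
  proof -
    obtain m n where "x = initial_segment f m" "y = initial_segment f n"
      using xy unfolding branch_def by blast
    then have "prefix x y \<or> prefix y x"
      using prefix_initial_segments nat_le_linear by blast
    with xy assms show ?thesis
      by (auto simp: antichain_def)
  qed
  then have "is_singleton (branch f \<inter> A)" if "branch f \<inter> A \<noteq> {}"
    using that by (intro is_singletonI') auto
  then show ?thesis
    by (metis finite.emptyI finite.insertI is_singleton_def)
qed

section \<open>Koenig-style arguments for sets without infinite antichains\<close>

lemma path_through_nodes:
  assumes "P []" and "\<And>s. P s \<Longrightarrow> \<exists>b. P (s @ [b])"
  obtains f where "\<And>n. P (initial_segment f n)"
proof -
  define next_label where "next_label s = (SOME b. P (s @ [b]))" for s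
  define s where "s = rec_nat [] (\<lambda>_ t. t @ [next_label t])"
  have s: "s 0 = []" "s (Suc n) = s n @ [next_label (s n)]" for n
    by (simp_all add: s_def)
  have "s n = initial_segment (\<lambda>n. next_label (s n)) n" for n
    by (induction n) (simp_all add: s initial_segment_Suc, simp add: initial_segment_def)
  moreover have "P (s n)" for n
    by (induction n) (use assms in \<open>auto simp: s next_label_def intro: someI_ex\<close>)
  ultimately show thesis
    using that by metis
qed

text \<open>Nodes that leave the path \<open>f\<close> at different levels are incomparable: at the
  smaller of the two levels, one of them still agrees with \<open>f\<close> and the other does not.
  The hypothesis provides infinitely many such levels, and one node of \<open>Y\<close> is chosen
  for each.\<close>

lemma infinite_antichain_of_deviating_nodes:
  assumes "\<And>n. \<exists>m\<ge>n. \<exists>y\<in>Y. m < length y \<and> (\<forall>i<m. y ! i = f i) \<and> y ! m \<noteq> f m"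
  shows "\<exists>A\<subseteq>Y. infinite A \<and> antichain A"
proof -
  define D where "D y m \<longleftrightarrow> m < length y \<and> (\<forall>i<m. y ! i = f i) \<and> y ! m \<noteq> f m" for y m
  define M where "M = {m. \<exists>y\<in>Y. D y m}"
  have "infinite M"
    unfolding infinite_nat_iff_unbounded_le
  proof
    fix n
    show "\<exists>m\<ge>n. m \<in> M"
      using assms[of n] by (auto simp: M_def D_def)
  qed
  have "\<forall>m\<in>M. \<exists>y. y \<in> Y \<and> D y m"
    by (auto simp: M_def)
  then obtain y where y: "\<And>m. m \<in> M \<Longrightarrow> y m \<in> Y \<and> D (y m) m"
    using bchoice[of M "\<lambda>m y. y \<in> Y \<and> D y m"] by blast
  have no_prefix: "\<not> prefix (y m) (y n)" if "m \<in> M" "n \<in> M" "m \<noteq> n" for m n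
  proof
    assume "prefix (y m) (y n)"
    then have "y n ! i = y m ! i" if "i < length (y m)" for i
      using that by (auto simp: prefix_def nth_append)
    moreover have "D (y m) m" "D (y n) n"
      using y that by blast+
    ultimately show False
      using that(3) unfolding D_def by (cases m n rule: linorder_cases) auto
  qed
  then have "inj_on y M"
    by (metis inj_onI prefix_order.refl)
  then have "infinite (y ` M)"
    using \<open>infinite M\<close> finite_image_iff by blast
  moreover have "antichain (y ` M)"
    using no_prefix unfolding antichain_def by blast
  ultimately show ?thesis
    using y by blast
qed

text \<open>Koenig's lemma gives a path \<open>f\<close> all of whose nodes have infinitely many
  extensions in \<open>Y\<close>. If its branch met \<open>Y\<close> in a finite set, nodes of
  \<open>Y\<close> would leave \<open>f\<close> at arbitrarily high levels and yield an infinite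
  antichain.\<close>

lemma ex_infinite_branch_Int:
  fixes Y :: "bool list set"
  assumes "infinite Y" and no_antichain: "\<And>A. A \<subseteq> Y \<Longrightarrow> antichain A \<Longrightarrow> finite A"
  shows "\<exists>f. infinite (branch f \<inter> Y)"
proof -
  have "\<exists>b. infinite {y\<in>Y. prefix (s @ [b]) y}" if "infinite {y\<in>Y. prefix s y}" for s
  proof (rule ccontr)
    assume "\<nexists>b. infinite {y\<in>Y. prefix (s @ [b]) y}"
    \<comment> \<open>There are only two values of \<open>b\<close>. The node \<open>s\<close> is
      added because it may lie in \<open>Y\<close> without extending a child of
      \<open>s\<close>.\<close>
    then have "finite (insert s (\<Union>b. {y\<in>Y. prefix (s @ [b]) y}))"
      by auto
    moreover have "{y\<in>Y. prefix s y} \<subseteq> insert s (\<Union>b. {y\<in>Y. prefix (s @ [b]) y})"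
    proof
      fix y assume "y \<in> {y\<in>Y. prefix s y}"
      then obtain t where "y = s @ t" "y \<in> Y"
        by (auto simp: prefix_def)
      then show "y \<in> insert s (\<Union>b. {y\<in>Y. prefix (s @ [b]) y})"
        by (cases t) (auto simp: prefix_def)
    qed
    ultimately show False
      using that finite_subset by blast
  qed
  then obtain f where f: "\<And>n. infinite {y\<in>Y. prefix (initial_segment f n) y}"
    using path_through_nodes[of "\<lambda>s. infinite {y\<in>Y. prefix s y}"] assms(1) by auto
  have "infinite (branch f \<inter> Y)"
  proof
    assume fin: "finite (branch f \<inter> Y)"
    have "\<exists>m\<ge>n. \<exists>y\<in>Y. m < length y \<and> (\<forall>i<m. y ! i = f i) \<and> y ! m \<noteq> f m" for n
    proof -
      have "infinite ({y\<in>Y. prefix (initial_segment f n) y} - branch f \<inter> Y)"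
        using f fin by (rule Diff_infinite_finite[rotated])
      then obtain y where y: "y \<in> Y" "prefix (initial_segment f n) y" "y \<notin> branch f"
        using infinite_imp_nonempty by blast
      \<comment> \<open>The level at which \<open>y\<close> leaves \<open>f\<close>; it is at least
        \<open>n\<close> because \<open>y\<close> extends
        \<open>initial_segment f n\<close>.\<close>
      define m where "m = (LEAST i. i < length y \<and> y ! i \<noteq> f i)"
      have "\<exists>i. i < length y \<and> y ! i \<noteq> f i"
        using y(3) unfolding mem_branch_iff list_eq_iff_nth_eq by auto
      then have m: "m < length y \<and> y ! m \<noteq> f m"
        unfolding m_def by (rule LeastI_ex)
      moreover have "\<forall>i<m. y ! i = f i"
      proof (intro allI impI)
        fix i assume "i < m"
        then have "\<not> (i < length y \<and> y ! i \<noteq> f i)"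
          unfolding m_def by (rule not_less_Least)
        with \<open>i < m\<close> m show "y ! i = f i"
          by auto
      qed
      moreover have "n \<le> m"
        using m y(2) unfolding prefix_initial_segment_iff by (meson not_le)
      ultimately show ?thesis
        using y(1) by blast
    qed
    then show False
      using infinite_antichain_of_deviating_nodes[of Y f] no_antichain by blast
  qed
  then show ?thesis
    by blast
qed

text \<open>Koenig's lemma is now applied to the set of branches: if it were infinite, some path
  \<open>f\<close> would have infinitely many of these branches through each of its nodes. Such
  branches leave \<open>f\<close> arbitrarily high, and each contains nodes of \<open>Y\<close>
  after leaving it, which again yields an infinite antichain.\<close>

lemma finite_branches_infinite_Int:
  fixes Y :: "bool list set"
  assumes no_antichain: "\<And>A. A \<subseteq> Y \<Longrightarrow> antichain A \<Longrightarrow> finite A"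
  shows "finite {h. infinite (branch h \<inter> Y)}" (is "finite ?H")
proof (rule ccontr)
  assume inf: "infinite ?H"
  have "\<exists>b. infinite {h\<in>?H. s @ [b] \<in> branch h}" if "infinite {h\<in>?H. s \<in> branch h}" for s
  proof (rule ccontr)
    assume "\<nexists>b. infinite {h\<in>?H. s @ [b] \<in> branch h}"
    then have "finite (\<Union>b. {h\<in>?H. s @ [b] \<in> branch h})"
      by auto
    moreover have "{h\<in>?H. s \<in> branch h} \<subseteq> (\<Union>b. {h\<in>?H. s @ [b] \<in> branch h})"
      by (auto simp: mem_branch_iff initial_segment_Suc)
    ultimately show False
      using that finite_subset by blast
  qed
  moreover have "[] \<in> branch h" for h :: "nat \<Rightarrow> bool"
    by (simp add: mem_branch_iff initial_segment_def)
  ultimately obtain f where f: "\<And>n. infinite {h\<in>?H. initial_segment f n \<in> branch h}"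
    using path_through_nodes[of "\<lambda>s. infinite {h\<in>?H. s \<in> branch h}"] inf by auto
  have "\<exists>m\<ge>n. \<exists>y\<in>Y. m < length y \<and> (\<forall>i<m. y ! i = f i) \<and> y ! m \<noteq> f m" for n
  proof -
    \<comment> \<open>The path \<open>f\<close> may itself be one of these branches and never
      deviates from itself, so it is removed.\<close>
    have "infinite ({h\<in>?H. initial_segment f n \<in> branch h} - {f})"
      using f by simp
    then obtain h where h: "infinite (branch h \<inter> Y)" "initial_segment f n \<in> branch h" "h \<noteq> f"
      using infinite_imp_nonempty by blast
    define m where "m = (LEAST i. h i \<noteq> f i)"
    have "\<exists>i. h i \<noteq> f i"
      using h(3) by blast
    then have m: "h m \<noteq> f m"
      unfolding m_def by (rule LeastI_ex)
    have below: "\<forall>i<m. h i = f i"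
      unfolding m_def using not_less_Least by blast
    have "n \<le> m"
      using h(2) m unfolding mem_branch_iff length_initial_segment initial_segment_eq_iff
      by (metis not_le)
    \<comment> \<open>Dropping the nodes of length at most \<open>m\<close> leaves a node of
      \<open>Y\<close> long enough to have an entry at position \<open>m\<close>, where
      \<open>h\<close> and \<open>f\<close> differ.\<close>
    have "infinite (branch h \<inter> Y - initial_segment h ` {..m})"
      using h(1) by simp
    then obtain y where y: "y \<in> branch h" "y \<in> Y" "y \<notin> initial_segment h ` {..m}"
      using infinite_imp_nonempty by blast
    then have "m < length y"
      by (metis atMost_iff image_eqI mem_branch_iff not_le)
    moreover have "y ! i = h i" if "i \<le> m" for i
      using y(1) that \<open>m < length y\<close>
      by (metis mem_branch_iff nth_initial_segment order.strict_trans1)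
    ultimately show ?thesis
      using \<open>n \<le> m\<close> y(2) m below by (metis less_imp_le order.refl)
  qed
  then show False
    using infinite_antichain_of_deviating_nodes[of Y f] no_antichain by blast
qed

text \<open>Zorn's lemma, since a union of a chain of almost disjoint families is almost disjoint.
  An infinite \<open>X\<close> that already belongs to \<open>M\<close> is its own witness
  \<open>Y\<close>.\<close>

lemma ex_maximal_ad_family:
  "\<exists>M\<subseteq>\<X>. ad_family M \<and> (\<forall>X\<in>\<X>. infinite X \<longrightarrow> (\<exists>Y\<in>M. infinite (X \<inter> Y)))"
proof -
  have "\<Union>\<C> \<in> {M. M \<subseteq> \<X> \<and> ad_family M}"
    if "subset.chain {M. M \<subseteq> \<X> \<and> ad_family M} \<C>" for \<C>
  proof -
    have "ad_family (\<Union>\<C>)"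
      unfolding ad_family_def
      by (rule pairwise_chain_Union)
        (use that in \<open>auto simp: subset_chain_def chain_subset_def ad_family_def\<close>)
    then show ?thesis
      using that by (auto simp: subset_chain_def)
  qed
  then obtain M where M: "M \<subseteq> \<X>" "ad_family M"
    and max: "\<And>N. N \<subseteq> \<X> \<Longrightarrow> ad_family N \<Longrightarrow> M \<subseteq> N \<Longrightarrow> N = M"
    using subset_Zorn'[of "{M. M \<subseteq> \<X> \<and> ad_family M}"] by auto
  have "\<exists>Y\<in>M. infinite (X \<inter> Y)" if X: "X \<in> \<X>" "infinite X" for X
  proof (rule ccontr)
    assume "\<not> ?thesis"
    then have fin: "\<forall>Y\<in>M. finite (X \<inter> Y)"
      by blast
    then have "ad_family (insert X M)"
      using M(2) by (auto simp: ad_family_def pairwise_insert ad_def Int_commute)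
    with max[of "insert X M"] X(1) M(1) have "X \<in> M"
      by auto
    with fin X(2) show False
      by auto
  qed
  with M show ?thesis
    by blast
qed

section \<open>Cardinalities of countable sets and of their power sets\<close>

lemma ctbl_subsets_UNIV:
  "ctbl_subsets (UNIV :: 'a::countable set) = {Y. infinite Y}"
proof -
  have "|Y| =o natLeq \<longleftrightarrow> infinite Y" for Y :: "'a set"
  proof -
    have "|Y| \<le>o |UNIV :: nat set|"
      using card_of_ordLeqI[of to_nat Y UNIV] by (simp add: inj_on_subset[OF inj_to_nat])
    then have "|Y| \<le>o natLeq"
      using card_of_nat ordLeq_ordIso_trans by blast
    then show ?thesis
      by (metis infinite_iff_natLeq_ordLeq ordIso_iff_ordLeq)
  qed
  then show ?thesis
    by (simp add: ctbl_subsets_def)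
qed

lemma continuum_eq: "continuum = |UNIV :: (nat \<Rightarrow> bool) set|"
  by (simp add: continuum_def cexp_def ctwo_def Field_natLeq Func_def Field_card_of)

text \<open>Sets are sent to characteristic functions on the codes of their elements. This bounds
  the size of any family of subsets of the tree.\<close>

lemma card_of_UNIV_set_countable_ordLeq_continuum:
  "|UNIV :: 'a::countable set set| \<le>o continuum"
proof -
  have "inj (\<lambda>(A :: 'a set) n. n \<in> to_nat ` A)"
  proof (rule injI)
    fix A B :: "'a set"
    assume "(\<lambda>n. n \<in> to_nat ` A) = (\<lambda>n. n \<in> to_nat ` B)"
    then have "to_nat ` A = to_nat ` B"
      by (metis Collect_mem_eq)
    then show "A = B"
      using inj_image_eq_iff[OF inj_to_nat] by blast
  qed
  then show ?thesis
    unfolding continuum_eq by (rule card_of_ordLeqI) simp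
qed

section \<open>The family \<open>F\<close> and the maximal families in its orthogonal\<close>

theorem theorem4p6:
  fixes \<kappa> :: "'k rel"
  assumes "Card_order \<kappa>" and "natLeq \<le>o \<kappa>" and "\<kappa> \<le>o continuum"
  shows "\<exists>F. F \<subseteq> ctbl_subsets T \<and> ad_family F \<and> |F| =o continuum \<and> ad_number_plus F =o \<kappa>"
proof -
  have field: "|Field \<kappa>| =o \<kappa>"
    using assms(1) by (rule card_of_Field_ordIso)
  then have "|Field \<kappa>| \<le>o |UNIV :: (nat \<Rightarrow> bool) set|"
    using assms(3) unfolding continuum_eq by (rule ordIso_ordLeq_trans)
  then obtain g :: "'k \<Rightarrow> nat \<Rightarrow> bool" where g: "inj_on g (Field \<kappa>)"
    using card_of_ordLeq[of "Field \<kappa>" "UNIV :: (nat \<Rightarrow> bool) set"] by auto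
  \<comment> \<open>Fixing the first entry leaves continuum many branches outside \<open>K\<close> even if \<open>\<kappa>\<close> is the continuum.\<close>
  have inj_case_nat: "inj (case_nat b)" for b :: bool
    by (rule injI) (metis nat.case(2) ext)
  define K where "K = (\<lambda>k. case_nat True (g k)) ` Field \<kappa>"
  have "inj_on (\<lambda>k. case_nat True (g k)) (Field \<kappa>)"
    using g by (auto simp: inj_on_def inj_eq[OF inj_case_nat])
  then have "|K| =o |Field \<kappa>|"
    unfolding K_def by (intro ordIso_symmetric[OF card_of_ordIsoI]) (rule inj_on_imp_bij_betw)
  then have K: "|K| =o \<kappa>"
    using field ordIso_transitive by blast
  have "|branch ` K| =o |K|"
    by (intro ordIso_symmetric[OF card_of_ordIsoI])
      (rule inj_on_imp_bij_betw, rule inj_on_subset[OF inj_branch subset_UNIV])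
  then have branches: "|branch ` K| =o \<kappa>"
    using K ordIso_transitive by blast
  have branches_inf: "natLeq \<le>o |branch ` K|"
    using assms(2) branches ordIso_symmetric ordLeq_ordIso_trans by blast

  obtain M :: "bool list set set" where M: "M \<subseteq> {A. infinite A \<and> antichain A}" "ad_family M"
    and M_max: "\<And>A. infinite A \<Longrightarrow> antichain A \<Longrightarrow> \<exists>B\<in>M. infinite (A \<inter> B)"
    using ex_maximal_ad_family[of "{A. infinite A \<and> antichain A}"] by auto
  define F where "F = M \<union> branch ` (- K)"

  have ad_branches: "ad_family (branch ` S)" for S :: "(nat \<Rightarrow> bool) set"
    by (auto simp: ad_family_def pairwise_def ad_def intro!: finite_branch_Int_branch)
  have perp_iff: "Y \<in> perp F \<longleftrightarrow> infinite Y \<and> (\<forall>X\<in>F. finite (X \<inter> Y))" for Y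
    by (simp add: perp_def ctbl_subsets_UNIV)
  have no_antichain: "finite A" if "Y \<in> perp F" "A \<subseteq> Y" "antichain A" for A Y
  proof (rule ccontr)
    assume "infinite A"
    then obtain B where B: "B \<in> M" "infinite (A \<inter> B)"
      using M_max \<open>antichain A\<close> by blast
    then have "infinite (B \<inter> Y)"
      using \<open>A \<subseteq> Y\<close> by (metis Int_commute Int_mono finite_subset order.refl)
    moreover have "B \<in> F"
      using B(1) by (simp add: F_def)
    ultimately show False
      using \<open>Y \<in> perp F\<close> perp_iff by blast
  qed
  have branch_in_perp: "branch f \<in> perp F" if "f \<in> K" for f
  proof -
    have "finite (X \<inter> branch f)" if "X \<in> F" for X
      using that \<open>f \<in> K\<close> M(1) unfolding F_def
      by (metis (no_types, lifting) ComplD Int_commute Un_iff finite_branch_Int_antichain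
          finite_branch_Int_branch image_iff mem_Collect_eq subsetD)
    then show ?thesis
      by (simp add: perp_iff infinite_branch)
  qed

  have mad_branches: "mad_in (perp F) (branch ` K)"
    unfolding mad_in_def
  proof (intro conjI notI)
    show "branch ` K \<subseteq> perp F"
      using branch_in_perp by blast
    show "ad_family (branch ` K)"
      by (rule ad_branches)
    assume "\<exists>X\<in>perp F. \<forall>Y\<in>branch ` K. ad X Y"
    then obtain X where X: "X \<in> perp F" "\<forall>f\<in>K. finite (X \<inter> branch f)"
      by (auto simp: ad_def)
    \<comment> \<open>Some branch meets \<open>X\<close> in an infinite set. If it is indexed in
      \<open>K\<close>, this contradicts the choice of \<open>X\<close>; otherwise it belongs to
      \<open>F\<close>, to which \<open>X\<close> is orthogonal.\<close>
    obtain f where f: "infinite (branch f \<inter> X)"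
      using ex_infinite_branch_Int[of X] no_antichain[OF X(1)] X(1) by (auto simp: perp_iff)
    then have "f \<notin> K"
      using X(2) by (metis Int_commute)
    then have "branch f \<in> F"
      by (simp add: F_def)
    then show False
      using f X(1) perp_iff by blast
  qed

  have mad_large: "\<kappa> \<le>o |G|" if G: "natLeq \<le>o |G|" "mad_in (perp F) G" for G
  proof -
    have "infinite G"
      using G(1) infinite_iff_natLeq_ordLeq by blast
    \<comment> \<open>Each branch from \<open>K\<close> lies in the orthogonal, so by maximality of
      \<open>G\<close> it is not almost disjoint from every member of \<open>G\<close>.\<close>
    have "\<exists>Y\<in>G. infinite (branch f \<inter> Y)" if "f \<in> K" for f
      using branch_in_perp[OF that] G(2) by (auto simp: mad_in_def ad_def)
    \<comment> \<open>\<open>K\<close> is covered by finite sets indexed by the infinite family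
      \<open>G\<close>, so it is no larger than \<open>G\<close>.\<close>
    then have "K \<subseteq> (\<Union>Y\<in>G. {f. infinite (branch f \<inter> Y)})"
      by blast
    then have "|K| \<le>o |\<Union>Y\<in>G. {f. infinite (branch f \<inter> Y)}|"
      by (rule card_of_mono1)
    also have "|\<Union>Y\<in>G. {f. infinite (branch f \<inter> Y)}| \<le>o |G|"
    proof (rule card_of_UNION_ordLeq_infinite[OF \<open>infinite G\<close>])
      show "\<forall>Y\<in>G. |{f. infinite (branch f \<inter> Y)}| \<le>o |G|"
      proof
        fix Y assume "Y \<in> G"
        then have "Y \<in> perp F"
          using G(2) by (auto simp: mad_in_def)
        then have "finite {f. infinite (branch f \<inter> Y)}"
          by (intro finite_branches_infinite_Int no_antichain)
        then show "|{f. infinite (branch f \<inter> Y)}| \<le>o |G|"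
          using \<open>infinite G\<close>
          by (intro ordLess_imp_ordLeq finite_ordLess_infinite card_of_Well_order)
            (simp_all add: Field_card_of)
      qed
    qed (rule card_of_refl[THEN ordIso_imp_ordLeq])
    finally show ?thesis
      using K ordIso_ordLeq_trans ordIso_symmetric by blast
  qed

  define R where "R = {|G| | G. natLeq \<le>o |G| \<and> mad_in (perp F) G}"
  \<comment> \<open>This witness bounds the minimum by \<kappa> and shows that \<open>R\<close> is
    nonempty, so \<open>min_card R\<close> is an attained minimum and not the default value.\<close>
  have in_R: "|branch ` K| \<in> R"
    using branches_inf mad_branches by (auto simp: R_def)
  have card_R: "Card_order r" if "r \<in> R" for r
    using that card_of_Card_order by (auto simp: R_def)
  have "min_card R \<in> R"
    using min_card_least(1)[of R] in_R card_R by blast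
  then have "\<kappa> \<le>o min_card R"
    using mad_large by (auto simp: R_def)
  moreover have "min_card R \<le>o \<kappa>"
    using min_card_least(2)[of R] in_R card_R branches ordLeq_ordIso_trans by blast
  ultimately have "ad_number_plus F =o \<kappa>"
    by (simp add: ad_number_plus_def ad_number_def R_def ordIso_iff_ordLeq)
  moreover have "F \<subseteq> ctbl_subsets T"
    using M(1) infinite_branch by (auto simp: F_def ctbl_subsets_UNIV)
  moreover have "ad_family F"
  proof -
    have "ad X Y \<and> ad Y X" if "X \<in> M" "Y \<in> branch ` (- K)" for X Y
      using that M(1) finite_branch_Int_antichain by (auto simp: ad_def Int_commute)
    then show ?thesis
      using M(2) ad_branches[of "- K"] unfolding F_def ad_family_def pairwise_def by blast
  qed
  moreover have "|F| =o continuum"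
  proof -
    \<comment> \<open>Every member of \<open>K\<close> has first entry \<open>True\<close>.\<close>
    have "case_nat False h \<notin> K" for h
      unfolding K_def by (auto dest: fun_cong[of _ _ 0])
    then have "(\<lambda>h. branch (case_nat False h)) ` UNIV \<subseteq> F"
      by (auto simp: F_def)
    moreover have "inj (\<lambda>h. branch (case_nat False h))"
      by (auto simp: inj_on_def inj_eq[OF inj_branch] inj_eq[OF inj_case_nat])
    ultimately have "continuum \<le>o |F|"
      unfolding continuum_eq by (meson card_of_ordLeq)
    moreover have "|F| \<le>o continuum"
      using card_of_mono1[OF subset_UNIV] card_of_UNIV_set_countable_ordLeq_continuum
      by (rule ordLeq_transitive)
    ultimately show ?thesis
      by (simp add: ordIso_iff_ordLeq)
  qed
  ultimately show ?thesis
    by blast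
qed

end
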